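(* Let $n\ge 1$ and let $A\subset\mathbb{N}^*$ be a set of $n$ consecutive positive integers. Then both $p_A(n)=\{p_a(n) : a\in A\}$ and $h_A(n)=\{h_a(n) : a\in A\}$ are regular sequences in $R_n=\mathbb{C}[x_1,\dots,x_n]$.
   Context: $\mathbb{N}^*$ denotes the set of positive integers. For $k\ge 1$, $p_k(n)=x_1^k+\cdots+x_n^k$ is the power sum of degree $k$ in $n$ variables, and $h_k(n)$ is the complete symmetric polynomial of degree $k$, i.e. the sum of all monomials of degree $k$ in $x_1,\dots,x_n$; both are elements of $R_n=\mathbb{C}[x_1,\dots,x_n]$. A set of $n$ homogeneous polynomials (of positive degree) in $R_n$ is a regular sequence if and only if their only common zero in $\mathbb{C}^n$ is $(0,\dots,0)$ (the order is irrelevant). *)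

theory Defs
  imports Complex_Main "HOL-Library.Poly_Mapping" "HOL-Library.Cardinality" "HOL-Library.FuncSet"
begin

text \<open>
  The ring \<open>R\<^sub>n\<close> of complex polynomials in \<open>n = CARD('n)\<close> variables indexed by the finite
  type \<open>'n\<close>: a monomial is its exponent function \<open>'n \<Rightarrow>\<^sub>0 nat\<close>, and a polynomial maps monomials
  to coefficients, multiplication being convolution.
\<close>

type_synonym 'n cpoly = "('n \<Rightarrow>\<^sub>0 nat) \<Rightarrow>\<^sub>0 complex"

definition pvar :: "'n::finite \<Rightarrow> 'n cpoly" where
  "pvar i = Poly_Mapping.single (Poly_Mapping.single i 1) 1"

definition power_sum :: "nat \<Rightarrow> 'n::finite cpoly" where
  "power_sum k = (\<Sum>i\<in>UNIV. pvar i ^ k)"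

definition monomials_of_degree :: "nat \<Rightarrow> ('n::finite \<Rightarrow>\<^sub>0 nat) set" where
  "monomials_of_degree k = {m. (\<Sum>i\<in>UNIV. Poly_Mapping.lookup m i) = k}"

definition complete_symmetric :: "nat \<Rightarrow> 'n::finite cpoly" where
  "complete_symmetric k = (\<Sum>m\<in>monomials_of_degree k. Poly_Mapping.single m 1)"

text \<open>The sum defining \<^const>\<open>complete_symmetric\<close> is a genuine finite sum:\<close>

lemma finite_monomials_of_degree: "finite (monomials_of_degree k :: ('n::finite \<Rightarrow>\<^sub>0 nat) set)"
proof (rule finite_imageD)
  show "inj_on Poly_Mapping.lookup (monomials_of_degree k :: ('n \<Rightarrow>\<^sub>0 nat) set)"
    by (simp add: inj_on_def poly_mapping_eqI)
  have "Poly_Mapping.lookup m i \<le> k" if "m \<in> monomials_of_degree k" for m :: "'n \<Rightarrow>\<^sub>0 nat" and i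
    using that member_le_sum[of i UNIV "Poly_Mapping.lookup m"]
    by (simp add: monomials_of_degree_def)
  then have "Poly_Mapping.lookup ` (monomials_of_degree k :: ('n \<Rightarrow>\<^sub>0 nat) set)
      \<subseteq> PiE UNIV (\<lambda>_. {..k})"
    by (auto simp: PiE_def Pi_def)
  then show "finite (Poly_Mapping.lookup ` (monomials_of_degree k :: ('n \<Rightarrow>\<^sub>0 nat) set))"
    by (rule finite_subset) (simp add: finite_PiE)
qed

text \<open>The ideal generated by \<open>S\<close>: the span of \<open>S\<close> in the ring viewed as a module over itself.\<close>

definition ideal_of :: "'a::comm_ring_1 set \<Rightarrow> 'a set" where
  "ideal_of S = module.span (*) S"

text \<open>
  Each \<open>f\<^sub>i\<close> is a non-zero-divisor on \<open>R / (f\<^sub>0, \<dots>, f\<^bsub>i-1\<^esub>)\<close>, and \<open>R / (f\<^sub>0, \<dots>, f\<^bsub>m-1\<^esub>) \<noteq> 0\<close>.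
\<close>

definition regular_sequence :: "'a::comm_ring_1 list \<Rightarrow> bool" where
  "regular_sequence fs \<longleftrightarrow>
     (\<forall>i<length fs. \<forall>g. fs ! i * g \<in> ideal_of (set (take i fs)) \<longrightarrow> g \<in> ideal_of (set (take i fs)))
     \<and> ideal_of (set fs) \<noteq> UNIV"

text \<open>
  For a finite family without a given order (such as \<open>p\<^sub>a\<close>, \<open>a \<in> A\<close>), regularity is required of
  every enumeration of the family. Enumerating the index set rather than the set of values means
  that a repeated value would be counted with its multiplicity.
\<close>

definition regular_family :: "('i \<Rightarrow> 'a::comm_ring_1) \<Rightarrow> 'i set \<Rightarrow> bool" where
  "regular_family f A \<longleftrightarrow>
     finite A \<and> (\<forall>is. distinct is \<and> set is = A \<longrightarrow> regular_sequence (map f is))"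

end

theory Submission
  imports Defs
begin

text \<open>
  Each family consists of homogeneous polynomials whose ideal contains a power of every variable.
  For \<open>h\<close> this follows from \<open>h\<^sub>k(B) = h\<^sub>k(B \<union> {j}) - x\<^sub>j h\<^bsub>k-1\<^esub>(B \<union> {j})\<close>, descending to a single
  variable; for \<open>p\<close> from a Vandermonde argument on combinations of the power sums.

  Regularity is then the Cohen-Macaulay property of \<open>R\<^sub>n\<close>. If \<open>x\<^sub>1\<^sup>N, \<dots>, x\<^sub>n\<^sup>N\<close> lie in the ideal of
  \<open>f\<^sub>1, \<dots>, f\<^sub>n\<close>, then \<open>H\<^bsub>j+1\<^esub>(f; R/(x\<^sub>1\<^sup>N, \<dots>, x\<^sub>j\<^sup>N)) = 0\<close> by descending induction on \<open>j\<close>: the case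
  \<open>j = n\<close> is trivial, and in each step multiplication by \<open>x\<^sub>j\<^sup>N\<close> is injective on coefficients but
  zero on Koszul homology. At \<open>j = 0\<close> every syzygy of \<open>f\<close> is a Koszul syzygy, so each \<open>f\<^sub>i\<close> is a
  non-zero-divisor modulo the others.
\<close>

subsection \<open>Ideals\<close>

context
begin

interpretation self_module: module "(*) :: 'a::comm_ring_1 \<Rightarrow> 'a \<Rightarrow> 'a"
  by unfold_locales (simp_all add: algebra_simps)

lemma ideal_of_eq_span: "ideal_of S = self_module.span S"
  by (simp add: ideal_of_def)

definition is_ideal :: "'a::comm_ring_1 set \<Rightarrow> bool" where
  "is_ideal J \<longleftrightarrow> module.subspace (*) J"

lemma is_idealI:
  assumes "0 \<in> J" "\<And>x y. x \<in> J \<Longrightarrow> y \<in> J \<Longrightarrow> x + y \<in> J" "\<And>c x. x \<in> J \<Longrightarrow> c * x \<in> J"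
  shows "is_ideal J"
  unfolding is_ideal_def by (rule self_module.subspaceI) (use assms in blast)+

lemma is_idealD:
  assumes "is_ideal J"
  shows "0 \<in> J" "x \<in> J \<Longrightarrow> y \<in> J \<Longrightarrow> x + y \<in> J" "x \<in> J \<Longrightarrow> y \<in> J \<Longrightarrow> x - y \<in> J"
    "x \<in> J \<Longrightarrow> c * x \<in> J"
  using assms unfolding is_ideal_def
  by (blast intro: self_module.subspace_0 self_module.subspace_add self_module.subspace_diff
      self_module.subspace_scale)+

lemma is_ideal_ideal_of: "is_ideal (ideal_of S)"
  unfolding is_ideal_def ideal_of_eq_span by (rule self_module.subspace_span)

lemma ideal_of_subset: "S \<subseteq> J \<Longrightarrow> is_ideal J \<Longrightarrow> ideal_of S \<subseteq> J"
  unfolding is_ideal_def ideal_of_eq_span by (rule self_module.span_minimal)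

lemma ideal_of_base: "x \<in> S \<Longrightarrow> x \<in> ideal_of S"
  unfolding ideal_of_eq_span by (rule self_module.span_base)

lemma ideal_of_mono: "S \<subseteq> T \<Longrightarrow> ideal_of S \<subseteq> ideal_of T"
  unfolding ideal_of_eq_span by (rule self_module.span_mono)

lemma ideal_of_empty: "ideal_of {} = {0}"
  unfolding ideal_of_eq_span by (rule self_module.span_empty)

lemma ideal_of_insert: "x \<in> ideal_of (insert y S) \<longleftrightarrow> (\<exists>c. x - c * y \<in> ideal_of S)"
  unfolding ideal_of_eq_span by (rule self_module.span_breakdown_eq)

lemma ideal_of_Un: "ideal_of (S \<union> T) = {x + y | x y. x \<in> ideal_of S \<and> y \<in> ideal_of T}"
  unfolding ideal_of_eq_span by (rule self_module.span_Un)

end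

lemma is_ideal_sum: "is_ideal J \<Longrightarrow> (\<And>i. i \<in> B \<Longrightarrow> x i \<in> J) \<Longrightarrow> sum x B \<in> J"
  by (induction B rule: infinite_finite_induct) (auto intro: is_idealD)

lemmas ideal_of_add = is_idealD(2)[OF is_ideal_ideal_of]
  and ideal_of_diff = is_idealD(3)[OF is_ideal_ideal_of]
  and ideal_of_mult = is_idealD(4)[OF is_ideal_ideal_of]
  and ideal_of_sum = is_ideal_sum[OF is_ideal_ideal_of]

text \<open>Coefficients are indexed by \<open>B\<close> instead of by the image, so
  \<open>f\<close> need not be injective.\<close>

lemma ideal_of_imageE:
  assumes "finite B" "x \<in> ideal_of (f ` B)"
  obtains c where "x = (\<Sum>i\<in>B. c i * f i)"
proof -
  have "\<exists>c. x = (\<Sum>i\<in>B. c i * f i)"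
    using assms
  proof (induction B arbitrary: x rule: finite_induct)
    case empty
    then show ?case by (simp add: ideal_of_empty)
  next
    case (insert b B)
    then obtain c where "x - c * f b \<in> ideal_of (f ` B)"
      by (auto simp: ideal_of_insert)
    then obtain e where e: "x - c * f b = (\<Sum>i\<in>B. e i * f i)"
      using insert.IH by blast
    have "(\<Sum>i\<in>B. (e(b := c)) i * f i) = (\<Sum>i\<in>B. e i * f i)"
      using insert.hyps by (intro sum.cong) auto
    then have "x = (\<Sum>i\<in>insert b B. (e(b := c)) i * f i)"
      using insert.hyps e by (simp add: algebra_simps)
    then show ?case by blast
  qed
  then show ?thesis using that by blast
qed

subsection \<open>The Koszul complex\<close>

text \<open>
  Koszul chains are encoded as alternating functions on lists of indices; a chain of degree \<open>k\<close>
  is only looked at on lists of length \<open>k\<close>. This makes the differential free of signs.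
\<close>

definition alternating :: "('i list \<Rightarrow> 'a::ab_group_add) \<Rightarrow> bool" where
  "alternating \<phi> \<longleftrightarrow> (\<forall>xs a b ys. \<phi> (xs @ a # b # ys) = - \<phi> (xs @ b # a # ys))
     \<and> (\<forall>xs a ys. \<phi> (xs @ a # a # ys) = 0)"

definition koszul_diff :: "'i set \<Rightarrow> ('i \<Rightarrow> 'a::comm_ring_1) \<Rightarrow> ('i list \<Rightarrow> 'a) \<Rightarrow> 'i list \<Rightarrow> 'a" where
  "koszul_diff A f \<phi> xs = (\<Sum>i\<in>A. f i * \<phi> (i # xs))"

text \<open>Exterior product of the degree one chain \<open>c\<close> with \<open>\<phi>\<close>,
  given by the Leibniz rule for contraction with the first index; hence the minus sign.\<close>

primrec koszul_wedge :: "('i \<Rightarrow> 'a::comm_ring_1) \<Rightarrow> ('i list \<Rightarrow> 'a) \<Rightarrow> 'i list \<Rightarrow> 'a" where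
  "koszul_wedge c \<phi> [] = 0"
| "koszul_wedge c \<phi> (x # xs) = c x * \<phi> xs - koszul_wedge c (\<lambda>ys. \<phi> (x # ys)) xs"

lemma alternatingI:
  assumes "\<And>xs a b ys. \<phi> (xs @ a # b # ys) = - \<phi> (xs @ b # a # ys)"
    and "\<And>xs a ys. \<phi> (xs @ a # a # ys) = 0"
  shows "alternating \<phi>"
  unfolding alternating_def using assms by blast

lemma alternating_swap: "alternating \<phi> \<Longrightarrow> \<phi> (xs @ a # b # ys) = - \<phi> (xs @ b # a # ys)"
  unfolding alternating_def by blast

lemma alternating_eq: "alternating \<phi> \<Longrightarrow> \<phi> (xs @ a # a # ys) = 0"
  unfolding alternating_def by blast

lemma alternating_Cons:
  assumes "alternating \<phi>"
  shows "alternating (\<lambda>ys. \<phi> (x # ys))"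
proof (rule alternatingI)
  show "\<phi> (x # xs @ a # b # ys) = - \<phi> (x # xs @ b # a # ys)" for xs a b ys
    using alternating_swap[OF assms, of "x # xs" a b ys] by simp
  show "\<phi> (x # xs @ a # a # ys) = 0" for xs a ys
    using alternating_eq[OF assms, of "x # xs" a ys] by simp
qed

text \<open>Adjacent swaps move one of two equal entries through the gap until they meet.\<close>

lemma alternating_not_distinct:
  assumes "alternating \<phi>" "\<not> distinct xs"
  shows "\<phi> xs = 0"
proof -
  have *: "\<phi> (us @ a # vs @ a # ws) = 0" for us a vs ws
  proof (induction vs arbitrary: us)
    case Nil
    then show ?case using alternating_eq[OF assms(1)] by simp
  next
    case (Cons v vs)
    have "\<phi> (us @ a # v # (vs @ a # ws)) = - \<phi> (us @ v # a # (vs @ a # ws))"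
      by (rule alternating_swap[OF assms(1)])
    then show ?case using Cons[of "us @ [v]"] by simp
  qed
  show ?thesis using not_distinct_decomp[OF assms(2)] * by force
qed

lemma alternating_diff:
  assumes "alternating \<phi>" "alternating \<psi>"
  shows "alternating (\<lambda>xs. \<phi> xs - \<psi> xs)"
proof (rule alternatingI)
  show "\<phi> (xs @ a # b # ys) - \<psi> (xs @ a # b # ys)
      = - (\<phi> (xs @ b # a # ys) - \<psi> (xs @ b # a # ys))" for xs a b ys
    using alternating_swap[OF assms(1), of xs a b ys] alternating_swap[OF assms(2), of xs a b ys]
    by simp
qed (simp add: assms alternating_eq)

lemma alternating_koszul_diff:
  assumes "alternating \<phi>"
  shows "alternating (koszul_diff A f \<phi>)"
  unfolding koszul_diff_def
proof (rule alternatingI)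
  fix xs :: "'a list" and a b ys
  have "\<phi> (i # xs @ a # b # ys) = - \<phi> (i # xs @ b # a # ys)" for i
    using alternating_swap[OF assms, of "i # xs" a b ys] by simp
  then have "(\<Sum>i\<in>A. f i * \<phi> (i # xs @ a # b # ys)) = (\<Sum>i\<in>A. - (f i * \<phi> (i # xs @ b # a # ys)))"
    by (intro sum.cong) (metis mult_minus_right)+
  then show "(\<Sum>i\<in>A. f i * \<phi> (i # xs @ a # b # ys)) = - (\<Sum>i\<in>A. f i * \<phi> (i # xs @ b # a # ys))"
    by (simp add: sum_negf)
next
  fix xs :: "'a list" and a ys
  have "\<phi> (i # xs @ a # a # ys) = 0" for i
    using alternating_eq[OF assms, of "i # xs" a ys] by simp
  then show "(\<Sum>i\<in>A. f i * \<phi> (i # xs @ a # a # ys)) = 0"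
    by simp
qed

lemma koszul_wedge_zero: "koszul_wedge c (\<lambda>ys. 0) xs = 0"
  by (induction xs) auto

lemma koszul_wedge_uminus: "koszul_wedge c (\<lambda>ys. - \<phi> ys) xs = - koszul_wedge c \<phi> xs"
  by (induction xs arbitrary: \<phi>) auto

lemma koszul_wedge_sum:
  "koszul_wedge c (\<lambda>ys. \<Sum>i\<in>A. e i * \<phi> i ys) xs = (\<Sum>i\<in>A. e i * koszul_wedge c (\<phi> i) xs)"
proof (induction xs arbitrary: \<phi>)
  case (Cons x xs)
  show ?case
    using Cons[of "\<lambda>i ys. \<phi> i (x # ys)"]
    by (simp add: algebra_simps sum_distrib_left sum_subtractf)
qed simp

text \<open>Two unfoldings leave \<open>c a * \<phi> (b # ys) - c b * \<phi> (a # ys)\<close> plus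
  the wedge of \<open>c\<close> with the double contraction of \<open>\<phi>\<close>; both are
  antisymmetric in \<open>a\<close> and \<open>b\<close>.\<close>

lemma alternating_koszul_wedge:
  assumes "alternating \<phi>"
  shows "alternating (koszul_wedge c \<phi>)"
proof (rule alternatingI)
  fix xs :: "'a list" and a b ys
  show "koszul_wedge c \<phi> (xs @ a # b # ys) = - koszul_wedge c \<phi> (xs @ b # a # ys)"
    using assms
  proof (induction xs arbitrary: \<phi>)
    case Nil
    have "(\<lambda>ys. \<phi> (a # b # ys)) = (\<lambda>ys. - \<phi> (b # a # ys))"
      using alternating_swap[OF Nil, of "[]" a b] by simp
    then show ?case by (simp add: koszul_wedge_uminus)
  next
    case (Cons x xs)
    have "\<phi> (xs @ a # b # ys) = - \<phi> (xs @ b # a # ys)"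
      by (rule alternating_swap[OF Cons.prems])
    then show ?case using Cons.IH[OF alternating_Cons[OF Cons.prems, of x]] by simp
  qed
next
  fix xs :: "'a list" and a ys
  show "koszul_wedge c \<phi> (xs @ a # a # ys) = 0"
    using assms
  proof (induction xs arbitrary: \<phi>)
    case Nil
    have "(\<lambda>ys. \<phi> (a # a # ys)) = (\<lambda>ys. 0)"
      using alternating_eq[OF Nil, of "[]" a] by simp
    then show ?case by (simp add: koszul_wedge_zero)
  next
    case (Cons x xs)
    then show ?case
      using Cons.IH[OF alternating_Cons[OF Cons.prems, of x]] alternating_eq[OF Cons.prems] by simp
  qed
qed

text \<open>The summand is antisymmetric in its two indices. Induction on \<open>A\<close> adds a
  row, a column and a diagonal entry, so the cancellation needs no division by 2.\<close>

lemma koszul_diff_koszul_diff: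
  assumes "finite A" "alternating \<phi>"
  shows "koszul_diff A f (koszul_diff A f \<phi>) xs = 0"
proof -
  have "(\<Sum>i\<in>A. \<Sum>j\<in>A. f i * (f j * \<phi> (j # i # xs))) = 0"
    using assms(1)
  proof (induction A rule: finite_induct)
    case (insert a A)
    have diag: "\<phi> (a # a # xs) = 0"
      using alternating_eq[OF assms(2), of "[]" a xs] by simp
    have swap: "\<phi> (i # a # xs) = - \<phi> (a # i # xs)" for i
      using alternating_swap[OF assms(2), of "[]" i a xs] by simp
    have "f i * (f a * \<phi> (a # i # xs)) + f a * (f i * \<phi> (i # a # xs)) = 0" for i
      unfolding swap[of i] by (simp add: algebra_simps)
    then have "(\<Sum>i\<in>A. f i * (f a * \<phi> (a # i # xs))) + (\<Sum>i\<in>A. f a * (f i * \<phi> (i # a # xs))) = 0"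
      by (subst sum.distrib[symmetric]) simp
    then show ?case
      using insert diag by (simp add: sum.distrib algebra_simps)
  qed simp
  then show ?thesis by (simp add: koszul_diff_def sum_distrib_left)
qed

text \<open>Wedging with \<open>c\<close> is a null-homotopy of multiplication by
  \<open>\<Sum>i\<in>A. c i * f i\<close>, so elements of the ideal of \<open>f\<close> kill Koszul
  homology. One unfolding of the wedge at \<open>i # xs\<close> gives it.\<close>

lemma koszul_homotopy:
  "koszul_diff A f (koszul_wedge c \<phi>) xs
     = (\<Sum>i\<in>A. c i * f i) * \<phi> xs - koszul_wedge c (koszul_diff A f \<phi>) xs"
proof -
  have "koszul_wedge c (koszul_diff A f \<phi>) xs = (\<Sum>i\<in>A. f i * koszul_wedge c (\<lambda>ys. \<phi> (i # ys)) xs)"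
    unfolding koszul_diff_def by (rule koszul_wedge_sum)
  then show ?thesis
    by (simp add: koszul_diff_def algebra_simps sum_subtractf sum_distrib_left)
qed

text \<open>Vanishing of the Koszul homology of \<open>f\<close> over R/J in degree
  \<open>k + 1\<close>, stated on representatives in R; \<open>k\<close> is the degree of the
  boundary of \<open>\<phi>\<close>.\<close>

definition koszul_exact :: "'i set \<Rightarrow> ('i \<Rightarrow> 'a::comm_ring_1) \<Rightarrow> 'a set \<Rightarrow> nat \<Rightarrow> bool" where
  "koszul_exact A f J k \<longleftrightarrow>
     (\<forall>\<phi>. alternating \<phi> \<and> (\<forall>xs. set xs \<subseteq> A \<and> length xs = k \<longrightarrow> koszul_diff A f \<phi> xs \<in> J) \<longrightarrow>
       (\<exists>\<psi>. alternating \<psi> \<and>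
         (\<forall>xs. set xs \<subseteq> A \<and> length xs = Suc k \<longrightarrow> \<phi> xs - koszul_diff A f \<psi> xs \<in> J)))"

lemma koszul_diff_in_ideal:
  assumes "is_ideal J" "\<And>i. i \<in> A \<Longrightarrow> \<phi> (i # xs) \<in> J"
  shows "koszul_diff A f \<phi> xs \<in> J"
  unfolding koszul_diff_def by (intro is_ideal_sum is_idealD(4) assms)

lemma koszul_wedge_in_ideal:
  assumes "is_ideal J" "\<And>ys. set ys \<subseteq> A \<Longrightarrow> length ys = k \<Longrightarrow> \<phi> ys \<in> J"
    and "set xs \<subseteq> A" "length xs = Suc k"
  shows "koszul_wedge c \<phi> xs \<in> J"
  using assms(2-)
proof (induction xs arbitrary: k \<phi>)
  case (Cons x xs)
  have "\<phi> xs \<in> J" using Cons.prems by simp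
  moreover have "koszul_wedge c (\<lambda>ys. \<phi> (x # ys)) xs \<in> J"
  proof (cases k)
    case 0
    then show ?thesis using Cons.prems is_idealD(1)[OF assms(1)] by simp
  next
    case (Suc l)
    show ?thesis
      by (rule Cons.IH[of l]) (use Cons.prems Suc in auto)
  qed
  ultimately show ?case
    using is_idealD(3,4)[OF assms(1)] by simp
qed simp

text \<open>By pigeonhole a list of \<open>card A + 1\<close> indices repeats one, so there are no
  nonzero chains above the top degree.\<close>

lemma koszul_exact_top:
  assumes "finite A" "is_ideal J"
  shows "koszul_exact A f J (card A)"
  unfolding koszul_exact_def
proof (intro allI impI exI[of _ "\<lambda>_. 0"] conjI)
  show "alternating (\<lambda>_::'a list. 0 :: 'b)" by (simp add: alternating_def)
  fix \<phi> :: "'a list \<Rightarrow> 'b" and xs :: "'a list"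
  assume \<phi>: "alternating \<phi> \<and> (\<forall>xs. set xs \<subseteq> A \<and> length xs = card A \<longrightarrow> koszul_diff A f \<phi> xs \<in> J)"
    and xs: "set xs \<subseteq> A \<and> length xs = Suc (card A)"
  have "\<not> distinct xs"
    using xs card_mono[OF assms(1)] by (metis Suc_n_not_le_n distinct_card)
  then show "\<phi> xs - koszul_diff A f (\<lambda>_. 0) xs \<in> J"
    using \<phi> is_idealD(1)[OF assms(2)] by (simp add: alternating_not_distinct koszul_diff_def)
qed

text \<open>
  The connecting homomorphism of \<open>0 \<rightarrow> R/J \<rightarrow> R/J \<rightarrow> R/J' \<rightarrow> 0\<close> (multiplication by \<open>g\<close>) is
  surjective, as \<open>g\<close> lies in the ideal of \<open>f\<close> and so kills Koszul homology. The additive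
  \<open>q\<close> divides by \<open>g\<close> in a way that keeps chains alternating.
\<close>

lemma koszul_exact_descend:
  assumes "finite A" "is_ideal J" "is_ideal J'" "J \<subseteq> J'"
    and g: "g = (\<Sum>i\<in>A. c i * f i)"
    and gJ': "\<And>u. g * u \<in> J'"
    and nzd: "\<And>u. g * u \<in> J \<Longrightarrow> u \<in> J"
    and q_add: "\<And>u v. q (u + v) = q u + q v"
    and q: "\<And>u. u \<in> J' \<Longrightarrow> u - g * q u \<in> J"
    and ex: "koszul_exact A f J' (Suc k)"
  shows "koszul_exact A f J k"
  unfolding koszul_exact_def
proof (intro allI impI)
  fix \<phi>
  assume "alternating \<phi> \<and> (\<forall>xs. set xs \<subseteq> A \<and> length xs = k \<longrightarrow> koszul_diff A f \<phi> xs \<in> J)"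
  then have \<phi>: "alternating \<phi>"
    and d\<phi>: "\<And>xs. set xs \<subseteq> A \<Longrightarrow> length xs = k \<Longrightarrow> koszul_diff A f \<phi> xs \<in> J" by auto
  note J = is_idealD[OF \<open>is_ideal J\<close>] and J' = is_idealD[OF \<open>is_ideal J'\<close>]
  let ?d = "koszul_diff A f" and ?s = "koszul_wedge c"
  have sd: "?s (?d \<phi>) xs \<in> J" if "set xs \<subseteq> A" "length xs = Suc k" for xs
    by (rule koszul_wedge_in_ideal[OF \<open>is_ideal J\<close> d\<phi> that])
  have ds: "?d (?s \<phi>) xs = g * \<phi> xs - ?s (?d \<phi>) xs" for xs
    unfolding g by (rule koszul_homotopy)
  \<comment> \<open>Since \<open>\<phi>\<close> is a cycle modulo \<open>J\<close>, the boundary of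
    \<open>?s \<phi>\<close> is \<open>g * \<phi>\<close> modulo \<open>J\<close>, hence zero modulo
    \<open>J'\<close>.\<close>
  have "?d (?s \<phi>) xs \<in> J'" if "set xs \<subseteq> A" "length xs = Suc k" for xs
    unfolding ds using sd[OF that] gJ' J'(3) \<open>J \<subseteq> J'\<close> by blast
  then obtain \<psi> where \<psi>: "alternating \<psi>"
    and \<psi>': "\<And>xs. set xs \<subseteq> A \<Longrightarrow> length xs = Suc (Suc k) \<Longrightarrow> ?s \<phi> xs - ?d \<psi> xs \<in> J'"
    using ex alternating_koszul_wedge[OF \<phi>] unfolding koszul_exact_def by metis
  \<comment> \<open>Subtracting a boundary keeps the boundary equal to \<open>g * \<phi>\<close>
    modulo \<open>J\<close>, while the relevant values now lie in \<open>J'\<close> and can be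
    divided by \<open>g\<close>.\<close>
  define \<theta> where "\<theta> xs = ?s \<phi> xs - ?d \<psi> xs" for xs
  have \<theta>: "alternating \<theta>"
    unfolding \<theta>_def
    by (intro alternating_diff alternating_koszul_wedge alternating_koszul_diff \<phi> \<psi>)
  have q0: "q 0 = 0" using q_add[of 0 0] by simp
  have qm: "q (- u) = - q u" for u
    using q_add[of u "- u"] q0 by (simp add: eq_neg_iff_add_eq_0 add.commute)
  have q\<theta>: "alternating (\<lambda>xs. q (\<theta> xs))"
  proof (rule alternatingI)
    show "q (\<theta> (xs @ a # b # ys)) = - q (\<theta> (xs @ b # a # ys))" for xs a b ys
      unfolding qm[symmetric] by (rule arg_cong[OF alternating_swap[OF \<theta>]])
  qed (simp add: alternating_eq[OF \<theta>] q0)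
  have "\<phi> xs - ?d (\<lambda>xs. q (\<theta> xs)) xs \<in> J" if xs: "set xs \<subseteq> A" "length xs = Suc k" for xs
  proof (rule nzd)
    have "?d (\<lambda>ys. \<theta> ys - g * q (\<theta> ys)) xs \<in> J"
      by (intro koszul_diff_in_ideal[OF \<open>is_ideal J\<close>] q) (use xs \<psi>' in \<open>auto simp: \<theta>_def simp del: koszul_wedge.simps\<close>)
    also have "?d (\<lambda>ys. \<theta> ys - g * q (\<theta> ys)) xs = ?d \<theta> xs - g * ?d (\<lambda>ys. q (\<theta> ys)) xs"
      by (simp add: koszul_diff_def algebra_simps sum_subtractf sum_distrib_left)
    also have "?d \<theta> xs = ?d (?s \<phi>) xs - ?d (?d \<psi>) xs"
      by (simp add: koszul_diff_def \<theta>_def right_diff_distrib sum_subtractf del: koszul_wedge.simps)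
    also have "?d (?d \<psi>) xs = 0"
      by (rule koszul_diff_koszul_diff[OF \<open>finite A\<close> \<psi>])
    finally have "g * \<phi> xs - ?s (?d \<phi>) xs - g * ?d (\<lambda>ys. q (\<theta> ys)) xs \<in> J"
      by (simp add: ds)
    from J(2)[OF this sd[OF xs]]
    show "g * (\<phi> xs - ?d (\<lambda>xs. q (\<theta> xs)) xs) \<in> J"
      by (simp add: algebra_simps)
  qed
  then show "\<exists>\<psi>. alternating \<psi> \<and>
      (\<forall>xs. set xs \<subseteq> A \<and> length xs = Suc k \<longrightarrow> \<phi> xs - ?d \<psi> xs \<in> J)"
    using q\<theta> by blast
qed

text \<open>The relation expressing \<open>u * f i\<close> is a Koszul cycle of degree one with
  value \<open>u\<close> at \<open>i\<close>. Since it is a boundary, that value is a combination of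
  the \<open>f l\<close> in which the term \<open>l = i\<close> vanishes by alternation.\<close>

lemma koszul_exact_zero_cancel:
  assumes "finite A" "i \<in> A" and ex: "koszul_exact A f {0} 0"
    and "u * f i \<in> ideal_of (f ` (A - {i}))"
  shows "u \<in> ideal_of (f ` (A - {i}))"
proof -
  obtain c where c: "u * f i = (\<Sum>l\<in>A - {i}. c l * f l)"
    using assms(1,4) by (auto elim: ideal_of_imageE[rotated])
  define \<phi> where "\<phi> xs = (case xs of [l] \<Rightarrow> if l = i then u else - c l | _ \<Rightarrow> 0)" for xs
  have "alternating \<phi>"
    by (rule alternatingI) (auto simp: \<phi>_def append_eq_Cons_conv split: list.split)
  moreover have "koszul_diff A f \<phi> [] = 0"
  proof -
    have "(\<Sum>l\<in>A - {i}. f l * \<phi> [l]) = - (\<Sum>l\<in>A - {i}. c l * f l)"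
      unfolding sum_negf[symmetric] by (rule sum.cong) (auto simp: \<phi>_def)
    then show ?thesis
      using c assms(1,2) by (simp add: koszul_diff_def sum.remove[of A i] \<phi>_def mult.commute)
  qed
  ultimately obtain \<psi> where \<psi>: "alternating \<psi>"
    and "\<And>xs. set xs \<subseteq> A \<Longrightarrow> length xs = Suc 0 \<Longrightarrow> \<phi> xs - koszul_diff A f \<psi> xs \<in> {0}"
    using ex unfolding koszul_exact_def by (metis length_0_conv singletonI)
  from this(2)[of "[i]"] have "u = (\<Sum>l\<in>A. f l * \<psi> [l, i])"
    using assms(2) by (simp add: \<phi>_def koszul_diff_def)
  also have "\<dots> = (\<Sum>l\<in>A - {i}. \<psi> [l, i] * f l)"
    using alternating_eq[OF \<psi>, of "[]" i "[]"] assms(1,2)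
    by (simp add: sum.remove[of A i] mult.commute)
  also have "\<dots> \<in> ideal_of (f ` (A - {i}))"
    by (intro ideal_of_sum ideal_of_mult ideal_of_base) auto
  finally show ?thesis .
qed


subsection \<open>Monomial ideals and degrees\<close>

lemma pvar_power: "pvar j ^ N = Poly_Mapping.single (Poly_Mapping.single j N) 1"
  by (induction N) (simp_all add: pvar_def mult_single single_add[symmetric])

lemma lookup_single_times:
  fixes u :: "'b::cancel_comm_monoid_add \<Rightarrow>\<^sub>0 'a::comm_semiring_1"
  shows "Poly_Mapping.lookup (Poly_Mapping.single k 1 * u) (k + m) = Poly_Mapping.lookup u m"
  by (simp add: lookup_mult lookup_single when_mult)

text \<open>The ideal generated by the powers \<open>pvar i ^ N\<close> for
  \<open>i \<in> B\<close>, in a form where membership is tested monomial by monomial.\<close>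

definition monomial_ideal :: "nat \<Rightarrow> 'n set \<Rightarrow> 'n::finite cpoly set" where
  "monomial_ideal N B = {u. \<forall>m\<in>Poly_Mapping.keys u. \<exists>i\<in>B. N \<le> Poly_Mapping.lookup m i}"

lemma is_ideal_monomial_ideal: "is_ideal (monomial_ideal N B)"
proof (rule is_idealI)
  show "0 \<in> monomial_ideal N B" by (simp add: monomial_ideal_def)
next
  fix x y assume "x \<in> monomial_ideal N B" "y \<in> monomial_ideal N B"
  then show "x + y \<in> monomial_ideal N B"
    using keys_add[of x y] unfolding monomial_ideal_def by blast
next
  fix c x assume x: "x \<in> monomial_ideal N B"
  show "c * x \<in> monomial_ideal N B"
    unfolding monomial_ideal_def
  proof (intro CollectI ballI)
    fix m assume "m \<in> Poly_Mapping.keys (c * x)"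
    then obtain a b where m: "m = a + b" "b \<in> Poly_Mapping.keys x"
      using keys_mult[of c x] by blast
    then obtain i where "i \<in> B" "N \<le> Poly_Mapping.lookup b i"
      using x by (auto simp: monomial_ideal_def)
    then show "\<exists>i\<in>B. N \<le> Poly_Mapping.lookup m i"
      using m by (auto simp: lookup_add intro!: bexI[of _ i])
  qed
qed

lemma monomial_ideal_mono: "B \<subseteq> C \<Longrightarrow> monomial_ideal N B \<subseteq> monomial_ideal N C"
  unfolding monomial_ideal_def by blast

lemma monomial_ideal_empty: "monomial_ideal N {} = {0}"
  by (auto simp: monomial_ideal_def)

lemma pvar_power_times_in_monomial_ideal: "j \<in> B \<Longrightarrow> pvar j ^ N * u \<in> monomial_ideal N B"
proof -
  assume "j \<in> B"
  then have "pvar j ^ N \<in> monomial_ideal N B"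
    by (auto simp: pvar_power monomial_ideal_def intro!: bexI[of _ j])
  then show ?thesis
    using is_idealD(4)[OF is_ideal_monomial_ideal, of "pvar j ^ N" N B u] by (simp add: mult.commute)
qed

lemma pvar_power_cancel_monomial_ideal:
  assumes "j \<notin> B" "pvar j ^ N * u \<in> monomial_ideal N B"
  shows "u \<in> monomial_ideal N B"
  unfolding monomial_ideal_def
proof (intro CollectI ballI)
  fix m assume "m \<in> Poly_Mapping.keys u"
  then have "Poly_Mapping.single j N + m \<in> Poly_Mapping.keys (pvar j ^ N * u)"
    by (simp add: in_keys_iff pvar_power lookup_single_times)
  then obtain i where "i \<in> B" "N \<le> Poly_Mapping.lookup (Poly_Mapping.single j N + m) i"
    using assms(2) unfolding monomial_ideal_def by blast
  then show "\<exists>i\<in>B. N \<le> Poly_Mapping.lookup m i"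
    using assms(1) by (auto simp: lookup_add lookup_single when_def split: if_splits intro!: bexI[of _ i])
qed

text \<open>Quotient of division by \<open>pvar j ^ N\<close>: exponents at \<open>j\<close> drop by
  \<open>N\<close>, and terms not divisible by this power are discarded.\<close>

definition monomial_quotient :: "'n \<Rightarrow> nat \<Rightarrow> 'n::finite cpoly \<Rightarrow> 'n cpoly" where
  "monomial_quotient j N = Poly_Mapping.map_key ((+) (Poly_Mapping.single j N))"

lemma monomial_quotient_add:
  "monomial_quotient j N (u + v) = monomial_quotient j N u + monomial_quotient j N v"
  by (simp add: monomial_quotient_def map_key_plus)

text \<open>The remainder consists of the terms of \<open>u\<close> whose exponent at
  \<open>j\<close> is below \<open>N\<close>; for these the divisibility must come from
  \<open>B\<close>.\<close>

lemma monomial_quotient_remainder: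
  assumes "u \<in> monomial_ideal N (insert j B)"
  shows "u - pvar j ^ N * monomial_quotient j N u \<in> monomial_ideal N B"
  unfolding monomial_ideal_def
proof (intro CollectI ballI)
  let ?q = "monomial_quotient j N u" and ?k = "Poly_Mapping.single j N"
  fix m assume m: "m \<in> Poly_Mapping.keys (u - pvar j ^ N * ?q)"
  have less: "Poly_Mapping.lookup m j < N"
  proof (rule ccontr)
    assume "\<not> ?thesis"
    then have "?k + (m - ?k) = m"
      by (intro poly_mapping_eqI) (auto simp: lookup_add lookup_minus lookup_single when_def)
    then have "Poly_Mapping.lookup (pvar j ^ N * ?q) m = Poly_Mapping.lookup ?q (m - ?k)"
      using lookup_single_times[of ?k ?q "m - ?k"] by (simp add: pvar_power)
    also have "\<dots> = Poly_Mapping.lookup u m"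
      using \<open>?k + (m - ?k) = m\<close> by (simp add: monomial_quotient_def map_key.rep_eq)
    finally show False using m by (simp add: in_keys_iff lookup_minus)
  qed
  have "m \<notin> Poly_Mapping.keys (pvar j ^ N * ?q)"
  proof
    assume "m \<in> Poly_Mapping.keys (pvar j ^ N * ?q)"
    then obtain b where "m = ?k + b"
      using keys_mult[of "pvar j ^ N" ?q] by (auto simp: pvar_power)
    then show False using less by (simp add: lookup_add)
  qed
  then have "m \<in> Poly_Mapping.keys u"
    using m by (simp add: in_keys_iff lookup_minus)
  then show "\<exists>i\<in>B. N \<le> Poly_Mapping.lookup m i"
    using assms less unfolding monomial_ideal_def by force
qed

lemma cancel_of_radical:
  fixes f :: "'i \<Rightarrow> 'n::finite cpoly"
  assumes "finite A" "card A = CARD('n)"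
    and radical: "\<And>j. \<exists>N. pvar j ^ N \<in> ideal_of (f ` A)"
    and "i \<in> A" "u * f i \<in> ideal_of (f ` (A - {i}))"
  shows "u \<in> ideal_of (f ` (A - {i}))"
proof -
  obtain E where E: "\<And>j. pvar j ^ E j \<in> ideal_of (f ` A)"
    using radical by metis
  define N where "N = Max (range E)"
  have N: "pvar j ^ N \<in> ideal_of (f ` A)" for j
  proof -
    have "pvar j ^ N = pvar j ^ (N - E j) * pvar j ^ E j"
      by (simp add: N_def flip: power_add)
    then show ?thesis using ideal_of_mult[OF E] by metis
  qed
  \<comment> \<open>\<open>C\<close> collects the variables whose powers have been dropped. The
    induction starts at the top degree, as \<open>card A = CARD('n)\<close>, and ends with the zero
    ideal and index 0.\<close>
  have "koszul_exact A f (monomial_ideal N (- C)) (card (- C))" for C :: "'n set"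
    using finite[of C]
  proof (induction C rule: finite_induct)
    case empty
    show ?case
      using koszul_exact_top[OF \<open>finite A\<close> is_ideal_monomial_ideal] assms(2) by simp
  next
    case (insert j C)
    define B where "B = - insert j C"
    have B: "- C = insert j B" "j \<notin> B"
      using insert.hyps by (auto simp: B_def)
    then have "card (- C) = Suc (card B)" by simp
    obtain c where c: "pvar j ^ N = (\<Sum>i\<in>A. c i * f i)"
      using ideal_of_imageE[OF \<open>finite A\<close> N] by blast
    show ?case
      unfolding B_def[symmetric]
    proof (rule koszul_exact_descend[OF \<open>finite A\<close> is_ideal_monomial_ideal is_ideal_monomial_ideal _ c,
            where q = "monomial_quotient j N"])
      show "monomial_ideal N B \<subseteq> monomial_ideal N (insert j B)"
        by (rule monomial_ideal_mono) blast
      show "koszul_exact A f (monomial_ideal N (insert j B)) (Suc (card B))"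
        using insert.IH \<open>card (- C) = Suc (card B)\<close> B(1) by simp
    qed (use B in \<open>auto intro: pvar_power_times_in_monomial_ideal pvar_power_cancel_monomial_ideal
          monomial_quotient_add monomial_quotient_remainder\<close>)
  qed
  from this[of UNIV] have "koszul_exact A f {0} 0"
    by (simp add: monomial_ideal_empty)
  from koszul_exact_zero_cancel[OF assms(1,4) this assms(5)] show ?thesis .
qed

section \<open>Degree, order and truncation of polynomials\<close>

definition monomial_degree :: "('n::finite \<Rightarrow>\<^sub>0 nat) \<Rightarrow> nat" where
  "monomial_degree m = (\<Sum>i\<in>UNIV. Poly_Mapping.lookup m i)"

lemma monomial_degree_add: "monomial_degree (a + b) = monomial_degree a + monomial_degree b"
  by (simp add: monomial_degree_def lookup_add sum.distrib)

lemma monomial_degree_single: "monomial_degree (Poly_Mapping.single i k) = k"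
  by (simp add: monomial_degree_def lookup_single when_def)

definition homogeneous :: "nat \<Rightarrow> 'n::finite cpoly \<Rightarrow> bool" where
  "homogeneous d f \<longleftrightarrow> (\<forall>m\<in>Poly_Mapping.keys f. monomial_degree m = d)"

definition has_order :: "nat \<Rightarrow> 'n::finite cpoly \<Rightarrow> bool" where
  "has_order d f \<longleftrightarrow> (\<forall>m\<in>Poly_Mapping.keys f. d \<le> monomial_degree m)"

lemma has_order_mult:
  assumes "has_order d f" "has_order e g"
  shows "has_order (d + e) (f * g)"
  unfolding has_order_def
proof
  fix m assume "m \<in> Poly_Mapping.keys (f * g)"
  then obtain a b where "m = a + b" "a \<in> Poly_Mapping.keys f" "b \<in> Poly_Mapping.keys g"
    using keys_mult[of f g] by blast
  then show "d + e \<le> monomial_degree m"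
    using assms by (auto simp: has_order_def monomial_degree_add intro: add_mono)
qed

lemma is_ideal_has_order: "is_ideal {f. has_order d f}"
proof (rule is_idealI)
  fix f g :: "'a cpoly"
  assume "f \<in> {f. has_order d f}" "g \<in> {f. has_order d f}"
  then show "f + g \<in> {f. has_order d f}"
    using keys_add[of f g] unfolding has_order_def by blast
next
  fix c f :: "'a cpoly" assume "f \<in> {f. has_order d f}"
  then show "c * f \<in> {f. has_order d f}"
    using has_order_mult[of 0 c d f] by (simp add: has_order_def)
qed (simp add: has_order_def)

lemma has_order_power: "has_order 1 f \<Longrightarrow> has_order k (f ^ k)"
proof (induction k)
  case (Suc k)
  then show ?case using has_order_mult[of 1 f k "f ^ k"] by simp
qed (simp add: has_order_def)

definition truncate_degree :: "nat \<Rightarrow> 'n::finite cpoly \<Rightarrow> 'n cpoly" where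
  "truncate_degree M = Poly_Mapping.mapp (\<lambda>m c. c when monomial_degree m < M)"

lemma lookup_truncate_degree:
  "Poly_Mapping.lookup (truncate_degree M u) m = (Poly_Mapping.lookup u m when monomial_degree m < M)"
  by (auto simp: truncate_degree_def lookup_mapp when_def in_keys_iff)

lemma truncate_degree_add: "truncate_degree M (u + v) = truncate_degree M u + truncate_degree M v"
  by (intro poly_mapping_eqI) (simp add: lookup_truncate_degree lookup_add when_add_distrib)

lemma truncate_degree_zero: "truncate_degree M 0 = 0"
  by (intro poly_mapping_eqI) (simp add: lookup_truncate_degree)

lemma truncate_degree_sum: "truncate_degree M (sum u B) = (\<Sum>i\<in>B. truncate_degree M (u i))"
  by (induction B rule: infinite_finite_induct) (simp_all add: truncate_degree_add truncate_degree_zero)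

lemma truncate_degree_low:
  assumes "\<And>m. m \<in> Poly_Mapping.keys u \<Longrightarrow> monomial_degree m < M"
  shows "truncate_degree M u = u"
  using assms by (intro poly_mapping_eqI) (auto simp: lookup_truncate_degree when_def in_keys_iff)

lemma truncate_degree_high: "has_order M u \<Longrightarrow> truncate_degree M u = 0"
  by (intro poly_mapping_eqI)
    (auto simp: lookup_truncate_degree when_def in_keys_iff has_order_def not_le[symmetric])

text \<open>Multiplication by \<open>f\<close> shifts degrees by \<open>d\<close>, so truncation
  passes to the cofactor. For \<open>M < d\<close> the natural number \<open>M - d\<close> is 0, and
  both sides are zero.\<close>

lemma truncate_degree_mult_homogeneous:
  assumes "homogeneous d f"
  shows "truncate_degree M (c * f) = truncate_degree (M - d) c * f"
proof -
  define l where "l = truncate_degree (M - d) c"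
  have "truncate_degree M (l * f) = l * f"
  proof (rule truncate_degree_low)
    fix m assume "m \<in> Poly_Mapping.keys (l * f)"
    then obtain a b where "m = a + b" "a \<in> Poly_Mapping.keys l" "b \<in> Poly_Mapping.keys f"
      using keys_mult[of l f] by blast
    then show "monomial_degree m < M"
      using assms by (auto simp: l_def homogeneous_def monomial_degree_add in_keys_iff
          lookup_truncate_degree when_def split: if_splits)
  qed
  moreover have "truncate_degree M ((c - l) * f) = 0"
  proof (rule truncate_degree_high)
    have "has_order (M - d) (c - l)"
      by (auto simp: has_order_def l_def in_keys_iff lookup_minus lookup_truncate_degree when_def
          split: if_splits)
    moreover have "has_order d f"
      using assms by (simp add: has_order_def homogeneous_def)
    ultimately have "has_order (M - d + d) ((c - l) * f)"
      by (rule has_order_mult)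
    then show "has_order M ((c - l) * f)"
      by (force simp: has_order_def)
  qed
  moreover have "c * f = l * f + (c - l) * f"
    by (simp add: algebra_simps)
  ultimately show ?thesis
    by (simp add: truncate_degree_add l_def)
qed

lemma truncate_degree_in_ideal:
  assumes "finite B" "\<And>b. b \<in> B \<Longrightarrow> homogeneous (d b) (f b)" "u \<in> ideal_of (f ` B)"
  shows "truncate_degree M u \<in> ideal_of (f ` B)"
proof -
  obtain c where "u = (\<Sum>b\<in>B. c b * f b)"
    using ideal_of_imageE[OF assms(1,3)] by blast
  then have "truncate_degree M u = (\<Sum>b\<in>B. truncate_degree (M - d b) (c b) * f b)"
    using truncate_degree_mult_homogeneous[OF assms(2)]
    by (auto simp: truncate_degree_sum intro: sum.cong)
  also have "\<dots> \<in> ideal_of (f ` B)"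
    by (intro ideal_of_sum ideal_of_mult ideal_of_base) auto
  finally show ?thesis .
qed

section \<open>Congruences modulo an ideal and powers of generators\<close>

lemma ideal_cong_mult:
  assumes "is_ideal J" "a - b \<in> J" "c - d \<in> J"
  shows "a * c - b * d \<in> J"
proof -
  have "c * (a - b) + b * (c - d) \<in> J"
    using is_idealD[OF assms(1)] assms(2,3) by simp
  then show ?thesis by (simp add: algebra_simps)
qed

lemma ideal_cong_power:
  assumes "is_ideal J" "a - b \<in> J"
  shows "a ^ k - b ^ k \<in> J"
  by (induction k) (use assms in \<open>auto simp: is_idealD(1) intro: ideal_cong_mult\<close>)

lemma ideal_cong_prod:
  assumes "is_ideal J" "\<And>t. t \<in> T \<Longrightarrow> x t - y t \<in> J"
  shows "prod x T - prod y T \<in> J"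
  using assms(2)
  by (induction T rule: infinite_finite_induct)
    (auto simp: is_idealD(1)[OF assms(1)] intro: ideal_cong_mult[OF assms(1)])

text \<open>One generator at a time, a congruence of \<open>x ^ K\<close> with
  \<open>c * f g\<close> modulo the others is raised to the \<open>M\<close>-th power.
  \<open>S\<close> varies so that it can hold \<open>f g\<close> while the others are
  treated.\<close>

lemma power_in_ideal_of_powers:
  assumes "finite G" "x ^ N \<in> ideal_of (S \<union> f ` G)"
  shows "\<exists>N. x ^ N \<in> ideal_of (S \<union> (\<lambda>a. f a ^ M) ` G)"
  using assms
proof (induction G arbitrary: S N rule: finite_induct)
  case (insert g G)
  let ?T = "S \<union> (\<lambda>a. f a ^ M) ` G"
  have "x ^ N \<in> ideal_of (insert (f g) S \<union> f ` G)"
    using insert.prems by simp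
  then obtain K where "x ^ K \<in> ideal_of (insert (f g) ?T)"
    using insert.IH by fastforce
  then obtain c where "x ^ K - c * f g \<in> ideal_of ?T"
    by (auto simp: ideal_of_insert)
  then have "(x ^ K) ^ M - (c * f g) ^ M \<in> ideal_of ?T"
    by (rule ideal_cong_power[OF is_ideal_ideal_of])
  then have "x ^ (K * M) - c ^ M * f g ^ M \<in> ideal_of ?T"
    by (simp add: power_mult power_mult_distrib)
  then have "x ^ (K * M) \<in> ideal_of (insert (f g ^ M) ?T)"
    unfolding ideal_of_insert by blast
  then show ?case by auto
qed auto

text \<open>
  Raising the generators after \<open>f\<^sub>i\<close> to a high power \<open>M\<close> preserves the radical, so
  \<open>cancel_of_radical\<close> gives cancellation modulo the earlier generators up to terms of order
  at least \<open>M\<close>, which homogeneity then removes.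
\<close>

lemma regular_family_homogeneous:
  fixes f :: "'i \<Rightarrow> 'n::finite cpoly"
  assumes "finite A" "card A = CARD('n)"
    and hom: "\<And>a. a \<in> A \<Longrightarrow> homogeneous (d a) (f a)" and pos: "\<And>a. a \<in> A \<Longrightarrow> d a > 0"
    and radical: "\<And>j. \<exists>N. pvar j ^ N \<in> ideal_of (f ` A)"
  shows "regular_family f A"
proof -
  have order: "has_order 1 (f a)" if "a \<in> A" for a
    using hom[OF that] pos[OF that] by (auto simp: has_order_def homogeneous_def)
  have cancel: "u \<in> ideal_of (f ` F)"
    if F: "F \<subseteq> A" "i \<in> A" "i \<notin> F" and u: "f i * u \<in> ideal_of (f ` F)" for F i u
  proof -
    define G where "G = A - insert i F"
    \<comment> \<open>All terms of \<open>u\<close> have degree below \<open>M\<close>; the inserted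
      0 covers \<open>u = 0\<close>.\<close>
    define M where "M = Suc (Max (insert 0 (monomial_degree ` Poly_Mapping.keys u)))"
    define f' where "f' a = (if a \<in> G then f a ^ M else f a)" for a
    have fin: "finite F" "finite G"
      using F \<open>finite A\<close> finite_subset by (auto simp: G_def)
    have low: "monomial_degree m < M" if "m \<in> Poly_Mapping.keys u" for m
      using that by (auto simp: M_def less_Suc_eq_le intro: Max_ge)
    have A: "f ` A = f ` insert i F \<union> f ` G"
      using F by (auto simp: G_def)
    have f'A: "f' ` A = f ` insert i F \<union> (\<lambda>a. f a ^ M) ` G"
      using F by (auto simp: G_def f'_def)
    have f'Ai: "f' ` (A - {i}) = f ` F \<union> (\<lambda>a. f a ^ M) ` G"
      using F by (auto simp: G_def f'_def)
    have "\<exists>N. pvar j ^ N \<in> ideal_of (f' ` A)" for j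
      using radical[of j] power_in_ideal_of_powers[OF fin(2)] unfolding A f'A by blast
    moreover have "u * f' i \<in> ideal_of (f' ` (A - {i}))"
    proof -
      have "u * f' i = f i * u" by (simp add: f'_def G_def mult.commute)
      then show ?thesis using u ideal_of_mono[of "f ` F" "f' ` (A - {i})"] f'Ai by auto
    qed
    ultimately have "u \<in> ideal_of (f' ` (A - {i}))"
      by (rule cancel_of_radical[OF assms(1,2) _ F(2)])
    then obtain v w where uvw: "u = v + w" and v: "v \<in> ideal_of (f ` F)"
      and w: "w \<in> ideal_of ((\<lambda>a. f a ^ M) ` G)"
      unfolding f'Ai ideal_of_Un by blast
    have "(\<lambda>a. f a ^ M) ` G \<subseteq> {h. has_order M h}"
      using order by (auto simp: G_def intro!: has_order_power)
    then have "has_order M w"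
      using w ideal_of_subset[OF _ is_ideal_has_order] by blast
    \<comment> \<open>Truncation at \<open>M\<close> fixes \<open>u\<close> and kills
      \<open>w\<close>.\<close>
    then have "u = truncate_degree M v"
      using uvw truncate_degree_low[OF low] by (metis truncate_degree_add truncate_degree_high add.right_neutral)
    then show ?thesis
      using truncate_degree_in_ideal[OF fin(1) _ v] hom F(1) by (metis subsetD)
  qed
  have "regular_sequence (map f is)" if "is": "distinct is" "set is = A" for "is"
    unfolding regular_sequence_def
  proof (intro conjI allI impI)
    fix i g
    assume i: "i < length (map f is)"
      and g: "map f is ! i * g \<in> ideal_of (set (take i (map f is)))"
    have "is ! i \<notin> set (take i is)"
      using i "is" by (auto simp: in_set_conv_nth nth_eq_iff_index_eq)
    then show "g \<in> ideal_of (set (take i (map f is)))"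
      using cancel[of "set (take i is)" "is ! i" g] i g "is" set_take_subset[of i "is"]
      by (auto simp: take_map)
  next
    \<comment> \<open>Properness: with generators of positive degree no element of the ideal has a
      constant term, so 1 is missing.\<close>
    have "ideal_of (set (map f is)) \<subseteq> {u. has_order 1 u}"
      by (rule ideal_of_subset[OF _ is_ideal_has_order]) (use order "is" in auto)
    moreover have "\<not> has_order 1 (1 :: 'n cpoly)"
      by (simp add: has_order_def monomial_degree_def)
    ultimately show "ideal_of (set (map f is)) \<noteq> UNIV" by auto
  qed
  then show ?thesis
    using \<open>finite A\<close> by (simp add: regular_family_def)
qed


subsection \<open>Power sums\<close>

lemma homogeneous_sum: "(\<And>i. i \<in> B \<Longrightarrow> homogeneous d (f i)) \<Longrightarrow> homogeneous d (sum f B)"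
  using keys_sum[of f B] unfolding homogeneous_def by blast

lemma homogeneous_power_sum: "homogeneous k (power_sum k)"
  unfolding power_sum_def
  by (intro homogeneous_sum) (simp add: homogeneous_def pvar_power monomial_degree_single)

text \<open>A further factor \<open>pvar k - pvar y\<close> turns the sum for \<open>a\<close> into
  the sum for \<open>Suc a\<close> minus \<open>pvar y\<close> times the sum for \<open>a\<close>.
  Each factor thus uses up one more of the consecutive power sums.\<close>

lemma power_sum_times_prod_in_ideal:
  fixes S :: "'n::finite cpoly set"
  assumes "\<And>k. m \<le> k \<Longrightarrow> k < m + n \<Longrightarrow> power_sum k \<in> ideal_of S"
    and "finite T" "m \<le> a" "a + card T < m + n"
  shows "(\<Sum>k\<in>UNIV. pvar k ^ a * (\<Prod>t\<in>T. pvar k - pvar t)) \<in> ideal_of S"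
  using assms(2-)
proof (induction T arbitrary: a rule: finite_induct)
  case empty
  then show ?case using assms(1)[of a] by (simp add: power_sum_def)
next
  case (insert y T)
  let ?s = "\<lambda>a. \<Sum>k\<in>UNIV. pvar k ^ a * (\<Prod>t\<in>T. pvar k - pvar t)"
  have "?s (Suc a) - pvar y * ?s a \<in> ideal_of S"
    using insert.prems insert.hyps by (intro ideal_of_diff ideal_of_mult insert.IH) auto
  also have "?s (Suc a) - pvar y * ?s a
      = (\<Sum>k\<in>UNIV. pvar k ^ a * (\<Prod>t\<in>insert y T. pvar k - pvar t))"
    using insert.hyps by (simp add: sum_distrib_left algebra_simps flip: sum_subtractf)
  finally show ?case .
qed

text \<open>The congruences of \<open>x ^ N t\<close> with multiples of \<open>y t\<close> modulo
  \<open>S\<close> are multiplied together.\<close>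

lemma power_in_ideal_of_product:
  assumes "finite T" "\<And>t. t \<in> T \<Longrightarrow> x ^ N t \<in> ideal_of (insert (y t) S)"
  shows "x ^ (\<Sum>t\<in>T. N t) \<in> ideal_of (insert (\<Prod>t\<in>T. y t) S)"
proof -
  obtain c where c: "\<And>t. t \<in> T \<Longrightarrow> x ^ N t - c t * y t \<in> ideal_of S"
    using assms(2) unfolding ideal_of_insert by metis
  have "(\<Prod>t\<in>T. x ^ N t) - (\<Prod>t\<in>T. c t * y t) \<in> ideal_of S"
    by (rule ideal_cong_prod[OF is_ideal_ideal_of c])
  then show ?thesis
    unfolding ideal_of_insert by (auto simp: power_sum prod.distrib)
qed

text \<open>
  \<open>T\<close> collects the variables not yet identified with \<open>x\<^sub>i\<close>. Modulo the identifications, the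
  combination of power sums weighted by \<open>\<Prod>t\<in>T. (x\<^sub>k - x\<^sub>t)\<close> isolates a nonzero multiple of
  \<open>x\<^sub>i\<^sup>m \<Prod>t\<in>T. (x\<^sub>i - x\<^sub>t)\<close>, and each factor can be made to vanish by one more identification.
\<close>

lemma pvar_power_in_power_sum_ideal:
  fixes S :: "'n::finite cpoly set"
  assumes S: "\<And>k. m \<le> k \<Longrightarrow> k < m + CARD('n) \<Longrightarrow> power_sum k \<in> ideal_of S"
    and "i \<notin> T"
  shows "\<exists>N. pvar i ^ N \<in> ideal_of (S \<union> (\<lambda>k. pvar i - pvar k) ` (- T))"
  using finite[of T] assms(2)
proof (induction T rule: finite_psubset_induct)
  case (psubset T)
  let ?S = "S \<union> (\<lambda>k. pvar i - pvar k) ` (- T)"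
  let ?J = "ideal_of ?S" and ?p = "\<lambda>k. pvar k ^ m * (\<Prod>t\<in>T. pvar k - pvar t)"
  note J = is_ideal_ideal_of[of ?S]
  have "card T < CARD('n)"
    using psubset.prems by (intro psubset_card_mono) auto
  then have "sum ?p UNIV \<in> ideal_of S"
    by (intro power_sum_times_prod_in_ideal[OF S]) auto
  then have "sum ?p UNIV \<in> ?J"
    using ideal_of_mono[of S ?S] by blast
  also have "sum ?p UNIV = sum ?p (- T)"
  proof (intro sum.mono_neutral_right ballI)
    fix k assume "k \<in> UNIV - - T"
    then have "(\<Prod>t\<in>T. pvar k - pvar t) = 0"
      by (intro prod_zero bexI[of _ k]) auto
    then show "?p k = 0" by simp
  qed auto
  finally have sum: "sum ?p (- T) \<in> ?J" .
  \<comment> \<open>Modulo \<open>?J\<close> every \<open>pvar k\<close> with \<open>k\<close>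
    outside \<open>T\<close> equals \<open>pvar i\<close>, so the surviving summands all
    agree.\<close>
  have "?p i - ?p k \<in> ?J" if "k \<in> - T" for k
  proof -
    have eq: "pvar i - pvar k \<in> ?J" using that by (intro ideal_of_base) auto
    show ?thesis
      by (intro ideal_cong_mult[OF J] ideal_cong_power[OF J] ideal_cong_prod[OF J]) (simp_all add: eq)
  qed
  then have "(\<Sum>k\<in>- T. ?p i - ?p k) \<in> ?J"
    by (rule ideal_of_sum)
  from ideal_of_add[OF sum this] have "of_nat (card (- T)) * ?p i \<in> ?J"
    by (simp add: sum_subtractf)
  \<comment> \<open>Characteristic zero enters here: the number of summands is invertible, being
    nonzero because \<open>i \<notin> T\<close>.\<close>
  then have "Poly_Mapping.single 0 (1 / of_nat (card (- T))) * (of_nat (card (- T)) * ?p i) \<in> ?J"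
    by (rule ideal_of_mult)
  moreover have "card (- T) \<noteq> 0" using psubset.prems by auto
  then have "Poly_Mapping.single 0 (1 / of_nat (card (- T))) * of_nat (card (- T)) = (1 :: 'n cpoly)"
    by (simp add: mult_single del: single_of_nat flip: single_of_nat)
  ultimately have p: "?p i \<in> ?J"
    by (simp flip: mult.assoc)
  \<comment> \<open>Making the factor for \<open>t\<close> vanish identifies \<open>pvar t\<close>
    with \<open>pvar i\<close>, which removes \<open>t\<close> from \<open>T\<close>.\<close>
  have "\<exists>N. pvar i ^ N \<in> ideal_of (insert (pvar i - pvar t) ?S)" if "t \<in> T" for t
  proof -
    have "- (T - {t}) = insert t (- T)" using that by auto
    then show ?thesis using psubset.IH[of "T - {t}"] psubset.prems that by auto
  qed
  then obtain N where "\<And>t. t \<in> T \<Longrightarrow> pvar i ^ N t \<in> ideal_of (insert (pvar i - pvar t) ?S)"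
    by metis
  then have "pvar i ^ (\<Sum>t\<in>T. N t) \<in> ideal_of (insert (\<Prod>t\<in>T. pvar i - pvar t) ?S)"
    by (intro power_in_ideal_of_product) auto
  then obtain c where "pvar i ^ (\<Sum>t\<in>T. N t) - c * (\<Prod>t\<in>T. pvar i - pvar t) \<in> ?J"
    unfolding ideal_of_insert by blast
  \<comment> \<open>Multiplying by \<open>pvar i ^ m\<close> turns the product into
    \<open>?p i\<close>, already known to lie in \<open>?J\<close>.\<close>
  then have "pvar i ^ m * (pvar i ^ (\<Sum>t\<in>T. N t) - c * (\<Prod>t\<in>T. pvar i - pvar t)) + c * ?p i \<in> ?J"
    by (intro ideal_of_add ideal_of_mult p)
  then have "pvar i ^ (m + (\<Sum>t\<in>T. N t)) \<in> ?J"
    by (simp add: algebra_simps power_add)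
  then show ?case by blast
qed

subsection \<open>Complete symmetric polynomials\<close>

lemma homogeneous_complete_symmetric: "homogeneous k (complete_symmetric k)"
  unfolding complete_symmetric_def
  by (intro homogeneous_sum) (auto simp: homogeneous_def monomials_of_degree_def monomial_degree_def)

definition monomials_in :: "nat \<Rightarrow> 'n set \<Rightarrow> ('n::finite \<Rightarrow>\<^sub>0 nat) set" where
  "monomials_in k B = {m. monomial_degree m = k \<and> Poly_Mapping.keys m \<subseteq> B}"

definition complete_symmetric_in :: "nat \<Rightarrow> 'n set \<Rightarrow> 'n::finite cpoly" where
  "complete_symmetric_in k B = (\<Sum>m\<in>monomials_in k B. Poly_Mapping.single m 1)"

lemma complete_symmetric_in_UNIV: "complete_symmetric_in k UNIV = complete_symmetric k"
  by (simp add: complete_symmetric_in_def complete_symmetric_def monomials_in_def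
      monomials_of_degree_def monomial_degree_def)

lemma finite_monomials_in: "finite (monomials_in k B)"
  by (rule finite_subset[OF _ finite_monomials_of_degree[of k]])
    (auto simp: monomials_in_def monomials_of_degree_def monomial_degree_def)

text \<open>A monomial of degree \<open>Suc k\<close> either avoids \<open>j\<close> or is
  \<open>pvar j\<close> times a unique monomial of degree \<open>k\<close>, which may again contain
  \<open>j\<close>.\<close>

lemma complete_symmetric_in_insert:
  assumes "j \<notin> B"
  shows "complete_symmetric_in (Suc k) (insert j B)
    = complete_symmetric_in (Suc k) B + pvar j * complete_symmetric_in k (insert j B)"
proof -
  let ?e = "Poly_Mapping.single j (1 :: nat)"
  have "m \<in> monomials_in (Suc k) B \<union> (+) ?e ` monomials_in k (insert j B)"
    if m: "m \<in> monomials_in (Suc k) (insert j B)" for m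
  proof (cases "j \<in> Poly_Mapping.keys m")
    case True
    then have "m = ?e + (m - ?e)"
      by (intro poly_mapping_eqI) (auto simp: lookup_add lookup_minus lookup_single when_def in_keys_iff)
    moreover have "m - ?e \<in> monomials_in k (insert j B)"
    proof -
      have "Suc k = monomial_degree (?e + (m - ?e))"
        using m \<open>m = ?e + (m - ?e)\<close> by (simp add: monomials_in_def)
      moreover have "Poly_Mapping.keys (m - ?e) \<subseteq> Poly_Mapping.keys m"
        by (auto simp: in_keys_iff lookup_minus)
      ultimately show ?thesis
        using m by (auto simp: monomials_in_def monomial_degree_add monomial_degree_single)
    qed
    ultimately show ?thesis by blast
  next
    case False
    then show ?thesis using m by (auto simp: monomials_in_def)
  qed
  moreover have "?e + m \<in> monomials_in (Suc k) (insert j B)" if "m \<in> monomials_in k (insert j B)" for m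
    using that keys_add[of ?e m]
    by (auto simp: monomials_in_def monomial_degree_add monomial_degree_single split: if_splits)
  moreover have "monomials_in (Suc k) B \<subseteq> monomials_in (Suc k) (insert j B)"
    by (auto simp: monomials_in_def)
  ultimately have split: "monomials_in (Suc k) (insert j B)
      = monomials_in (Suc k) B \<union> (+) ?e ` monomials_in k (insert j B)"
    by blast
  have "j \<in> Poly_Mapping.keys (?e + m)" for m
    by (simp add: in_keys_iff lookup_add)
  then have disj: "monomials_in (Suc k) B \<inter> (+) ?e ` monomials_in k (insert j B) = {}"
    using assms by (auto simp: monomials_in_def)
  have "(\<Sum>m\<in>(+) ?e ` monomials_in k (insert j B). Poly_Mapping.single m 1)
      = pvar j * complete_symmetric_in k (insert j B)"
    by (subst sum.reindex)
      (auto simp: complete_symmetric_in_def sum_distrib_left pvar_def mult_single inj_on_def)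
  then show ?thesis
    unfolding complete_symmetric_in_def split
    by (subst sum.union_disjoint[OF _ _ disj]) (auto simp: finite_monomials_in complete_symmetric_in_def)
qed

lemma complete_symmetric_in_singleton: "complete_symmetric_in k {j} = pvar j ^ k"
proof -
  have "m = Poly_Mapping.single j k" if "monomial_degree m = k" "Poly_Mapping.keys m \<subseteq> {j}" for m
  proof -
    have zero: "Poly_Mapping.lookup m i = 0" if "i \<noteq> j" for i
      using that \<open>Poly_Mapping.keys m \<subseteq> {j}\<close> by (metis in_keys_iff singletonD subsetD)
    then have "monomial_degree m = Poly_Mapping.lookup m j"
      unfolding monomial_degree_def by (subst sum.remove[of _ j]) auto
    then show ?thesis
      using zero that(1) by (intro poly_mapping_eqI) (simp add: lookup_single when_def)
  qed
  then have "monomials_in k {j} = {Poly_Mapping.single j k}"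
    by (auto simp: monomials_in_def monomial_degree_single split: if_splits)
  then show ?thesis by (simp add: complete_symmetric_in_def pvar_power)
qed

text \<open>Solving \<open>complete_symmetric_in_insert\<close> for the polynomial without
  \<open>j\<close> also requires the preceding degree, so each dropped variable raises the lower
  bound on \<open>k\<close> by one.\<close>

lemma complete_symmetric_in_in_ideal:
  fixes S :: "'n::finite cpoly set"
  assumes "\<And>k. m \<le> k \<Longrightarrow> k < m + n \<Longrightarrow> complete_symmetric k \<in> ideal_of S"
    and "m + card C \<le> k" "k < m + n"
  shows "complete_symmetric_in k (- C) \<in> ideal_of S"
  using finite[of C] assms(2-)
proof (induction C arbitrary: k rule: finite_induct)
  case empty
  then show ?case using assms(1) by (simp add: complete_symmetric_in_UNIV)
next
  case (insert j C)
  let ?B = "- insert j C"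
  obtain l where l: "k = Suc l" using insert by (cases k) auto
  have B: "- C = insert j ?B" using insert.hyps by auto
  have "complete_symmetric_in k (- C) - pvar j * complete_symmetric_in l (- C) \<in> ideal_of S"
    using insert l by (intro ideal_of_diff ideal_of_mult insert.IH) auto
  then show ?case
    unfolding B l by (subst (asm) complete_symmetric_in_insert) auto
qed

theorem proposition2p9:
  fixes A :: "nat set" and m :: nat
  assumes "m \<ge> 1" and "A = {m ..< m + CARD('n::finite)}"
  shows "regular_family (power_sum :: nat \<Rightarrow> 'n cpoly) A
       \<and> regular_family (complete_symmetric :: nat \<Rightarrow> 'n cpoly) A"
proof
  have A: "finite A" "card A = CARD('n)" "\<And>a. a \<in> A \<Longrightarrow> a > 0"
    using assms by auto
  \<comment> \<open>With \<open>T = UNIV - {j}\<close> the only identification is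
    \<open>pvar j\<close> with itself, which adds just the generator 0.\<close>
  have "\<exists>N. pvar j ^ N \<in> ideal_of ((power_sum :: nat \<Rightarrow> 'n cpoly) ` A)" for j
    using pvar_power_in_power_sum_ideal[of m "power_sum ` A" j "UNIV - {j}"]
    by (auto simp: assms(2) ideal_of_base ideal_of_insert)
  then show "regular_family (power_sum :: nat \<Rightarrow> 'n cpoly) A"
    using regular_family_homogeneous[where d = "\<lambda>a. a", OF A(1,2) homogeneous_power_sum A(3)] by blast
  have "pvar j ^ (m + (CARD('n) - 1)) \<in> ideal_of ((complete_symmetric :: nat \<Rightarrow> 'n cpoly) ` A)" for j
  proof -
    \<comment> \<open>When all variables but \<open>j\<close> are dropped, only the largest degree
      in \<open>A\<close> remains available.\<close>
    have "complete_symmetric_in (m + (CARD('n) - 1)) (- (- {j})) \<in> ideal_of (complete_symmetric ` A)"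
      by (rule complete_symmetric_in_in_ideal[of m "CARD('n)"])
        (auto simp: assms(2) ideal_of_base Compl_eq_Diff_UNIV card_Diff_singleton)
    then show ?thesis by (simp add: complete_symmetric_in_singleton)
  qed
  then show "regular_family (complete_symmetric :: nat \<Rightarrow> 'n cpoly) A"
    using regular_family_homogeneous[where d = "\<lambda>a. a", OF A(1,2) homogeneous_complete_symmetric A(3)]
    by blast
qed

end
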